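(* Let $G_1,G_2$ and $U$ be finite groups. Then the $(G_1,G_2)$-biset $\mathcal{S}_{G_1\times G_2}(U)$ is the tensor product $$\mathcal{S}_{G_1\times G_2}(U) = \mathcal{M}_{G_1}(U)\times_{\mathrm{Aut}(U)}\mathcal{M}_{G_2}(U)^{\mathrm{op}},$$ i.e., the map $\Pi\colon \mathcal{M}_{G_1}(U)\times\mathcal{M}_{G_2}(U)\to\mathcal{S}_{G_1\times G_2}(U)$, $\Pi(\theta_1,\theta_2)=\theta_1\theta_2^{-1}$, induces an isomorphism of $(G_1,G_2)$-bisets from the right-hand side to the left-hand side.
   Context: Homomorphisms act from the right and are composed accordingly. A section of a finite group $G$ is a pair $(P,K)$ of subgroups with $K\trianglelefteq P$. A $U$-morphism of $G$ is an isomorphism $\theta\colon P/K\to U$ where $(P,K)$ is a section of $G$; $\mathcal{M}_G(U)$ is the set of all of them. $G$ acts on $\mathcal{M}_G(U)$ by $\theta^a=\gamma_a^{-1}\theta$, where $\gamma_a\colon P/K\to P^a/K^a$ is conjugation by $a\in G$ (as a left action: $a\cdot\theta=\theta^{a^{-1}}$), and $\mathrm{Aut}(U)$ acts on the right by $(\theta,\alpha)\mapsto\theta\alpha$, so $\mathcal{M}_G(U)$ is a $(G,\mathrm{Aut}(U))$-biset (left and right actions commute). By Goursat's Lemma, subgroups $L$ of $G_1\times G_2$ correspond bijectively to isomorphisms $\theta\colon P_1/K_1\to P_2/K_2$ with $(P_i,K_i)$ a section of $G_i$, via $L=\{(a_1,a_2)\in P_1\times P_2 : (a_1K_1)^\theta=a_2K_2\}$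 (the graph of $\theta$); $L$ and $\theta$ are identified. $L$ is a $U$-subgroup if $P_1/K_1\cong P_2/K_2\cong U$, and $\mathcal{S}_{G_1\times G_2}(U)$ is the set of all $U$-subgroups of $G_1\times G_2$, a $(G_1,G_2)$-biset via conjugation: $a_1\cdot L\cdot a_2=L^{(a_1^{-1},a_2)}$. The opposite of an $(A,B)$-biset $Y$ is the $(B,A)$-biset $Y^{\mathrm{op}}$ with underlying set $Y$ and actions $b\cdot y\cdot a=a^{-1}yb^{-1}$. The tensor product of an $(A,B)$-biset $X$ and a $(B,C)$-biset $Y$ is the $(A,C)$-biset $X\times_B Y=(X\times Y)/B$ of $B$-orbits on $X\times Y$ under $(x,y).b=(x.b,b^{-1}.y)$. *)

theory Defs
  imports "HOL-Algebra.Group_Action"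
begin

section \<open>Bisets\<close>

record ('a, 'b, 'x) biset =
  bset :: "'x set"
  lact :: "'a \<Rightarrow> 'x \<Rightarrow> 'x"
  ract :: "'x \<Rightarrow> 'b \<Rightarrow> 'x"

locale biset = A: group A + B: group B
  for A :: "('a, 'm) monoid_scheme" and B :: "('b, 'n) monoid_scheme"
    and X :: "('a, 'b, 'x) biset" +
  assumes lact_closed: "\<lbrakk>a \<in> carrier A; x \<in> bset X\<rbrakk> \<Longrightarrow> lact X a x \<in> bset X"
    and ract_closed: "\<lbrakk>x \<in> bset X; b \<in> carrier B\<rbrakk> \<Longrightarrow> ract X x b \<in> bset X"
    and lact_one: "x \<in> bset X \<Longrightarrow> lact X \<one>\<^bsub>A\<^esub> x = x"
    and ract_one: "x \<in> bset X \<Longrightarrow> ract X x \<one>\<^bsub>B\<^esub> = x"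
    and lact_mult: "\<lbrakk>a \<in> carrier A; a' \<in> carrier A; x \<in> bset X\<rbrakk>
      \<Longrightarrow> lact X (a \<otimes>\<^bsub>A\<^esub> a') x = lact X a (lact X a' x)"
    and ract_mult: "\<lbrakk>b \<in> carrier B; b' \<in> carrier B; x \<in> bset X\<rbrakk>
      \<Longrightarrow> ract X x (b \<otimes>\<^bsub>B\<^esub> b') = ract X (ract X x b) b'"
    and acts_commute: "\<lbrakk>a \<in> carrier A; b \<in> carrier B; x \<in> bset X\<rbrakk>
      \<Longrightarrow> ract X (lact X a x) b = lact X a (ract X x b)"

definition biset_iso ::
  "('a, 'm) monoid_scheme \<Rightarrow> ('b, 'n) monoid_scheme \<Rightarrow> ('a, 'b, 'x) biset \<Rightarrow> ('a, 'b, 'y) biset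
    \<Rightarrow> ('x \<Rightarrow> 'y) set"
  where "biset_iso A B X Y = {f. biset A B X \<and> biset A B Y \<and> bij_betw f (bset X) (bset Y) \<and>
    (\<forall>a \<in> carrier A. \<forall>x \<in> bset X. f (lact X a x) = lact Y a (f x)) \<and>
    (\<forall>x \<in> bset X. \<forall>b \<in> carrier B. f (ract X x b) = ract Y (f x) b)}"

definition opposite_biset ::
  "('a, 'm) monoid_scheme \<Rightarrow> ('b, 'n) monoid_scheme \<Rightarrow> ('a, 'b, 'x) biset \<Rightarrow> ('b, 'a, 'x) biset"
  where "opposite_biset A B Y =
    \<lparr>bset = bset Y,
     lact = (\<lambda>b y. ract Y y (inv\<^bsub>B\<^esub> b)),
     ract = (\<lambda>y a. lact Y (inv\<^bsub>A\<^esub> a) y)\<rparr>"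

definition middle_act ::
  "('b, 'm) monoid_scheme \<Rightarrow> ('a, 'b, 'x) biset \<Rightarrow> ('b, 'c, 'y) biset \<Rightarrow> 'b \<Rightarrow> 'x \<times> 'y \<Rightarrow> 'x \<times> 'y"
  where "middle_act B X Y b = (\<lambda>(x, y). (ract X x b, lact Y (inv\<^bsub>B\<^esub> b) y))"

text \<open>
  \<^term>\<open>middle_act B X Y\<close> is a right action of \<^term>\<open>B\<close>, so it does not satisfy
  \<^term>\<open>group_action\<close>. The library's \<^term>\<open>orbit\<close> and \<^term>\<open>orbits\<close> only use
  the formula \<open>{\<phi> b z | b. b \<in> carrier B}\<close>, which is also the orbit of a right action.
  The outer groups act on an orbit by acting on each of its pairs.
\<close>

definition tensor_biset ::
  "('b, 'm) monoid_scheme \<Rightarrow> ('a, 'b, 'x) biset \<Rightarrow> ('b, 'c, 'y) biset \<Rightarrow> ('a, 'c, ('x \<times> 'y) set) biset"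
  where "tensor_biset B X Y =
    \<lparr>bset = orbits B (bset X \<times> bset Y) (middle_act B X Y),
     lact = (\<lambda>a Z. (\<lambda>(x, y). (lact X a x, y)) ` Z),
     ract = (\<lambda>Z c. (\<lambda>(x, y). (x, ract Y y c)) ` Z)\<rparr>"


section \<open>Sections and \<open>U\<close>-morphisms\<close>

definition is_section :: "('a, 'm) monoid_scheme \<Rightarrow> 'a set \<Rightarrow> 'a set \<Rightarrow> bool"
  where "is_section G P K \<longleftrightarrow> subgroup P G \<and> K \<lhd> G\<lparr>carrier := P\<rparr>"

definition sec_quot :: "('a, 'm) monoid_scheme \<Rightarrow> 'a set \<Rightarrow> 'a set \<Rightarrow> 'a set monoid"
  where "sec_quot G P K = G\<lparr>carrier := P\<rparr> Mod K"

text \<open>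
  A morphism \<open>\<theta>: P/K \<rightarrow> U\<close> is encoded as a triple \<open>(P, K, \<theta>)\<close>, because a HOL function
  does not determine its domain. It is extensional on \<open>P/K\<close>, so that equality of triples is
  equality of morphisms.
\<close>

type_synonym ('a, 'u) umor = "'a set \<times> 'a set \<times> ('a set \<Rightarrow> 'u)"

definition U_morphisms :: "('a, 'm) monoid_scheme \<Rightarrow> ('u, 'n) monoid_scheme \<Rightarrow> ('a, 'u) umor set"
  where "U_morphisms G U = {(P, K, \<theta>). is_section G P K \<and> \<theta> \<in> iso (sec_quot G P K) U \<and>
    \<theta> \<in> extensional (carrier (sec_quot G P K))}"

text \<open>\<open>S\<^sup>a = a\<^sup>-\<^sup>1 S a\<close>; on the cosets of a section this is also the map \<open>\<gamma>\<^sub>a\<close>.\<close>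

definition conj_set :: "('a, 'm) monoid_scheme \<Rightarrow> 'a \<Rightarrow> 'a set \<Rightarrow> 'a set"
  where "conj_set G a S = (\<lambda>x. inv\<^bsub>G\<^esub> a \<otimes>\<^bsub>G\<^esub> x \<otimes>\<^bsub>G\<^esub> a) ` S"

text \<open>
  Morphisms are composed from left to right in the mathematical notation, whereas
  \<^term>\<open>compose S g f\<close> applies \<^term>\<open>f\<close> first. So \<open>\<theta>\<^sup>a = \<gamma>\<^sub>a\<^sup>-\<^sup>1\<theta>\<close> and \<open>\<theta>\<alpha>\<close> are as follows.
\<close>

definition umor_conj :: "('a, 'm) monoid_scheme \<Rightarrow> ('a, 'u) umor \<Rightarrow> 'a \<Rightarrow> ('a, 'u) umor"
  where "umor_conj G = (\<lambda>(P, K, \<theta>) a. (conj_set G a P, conj_set G a K,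
    compose (carrier (sec_quot G (conj_set G a P) (conj_set G a K)))
      \<theta> (inv_into (carrier (sec_quot G P K)) (conj_set G a))))"

definition umor_aut :: "('a, 'm) monoid_scheme \<Rightarrow> ('a, 'u) umor \<Rightarrow> ('u \<Rightarrow> 'u) \<Rightarrow> ('a, 'u) umor"
  where "umor_aut G = (\<lambda>(P, K, \<theta>) \<alpha>. (P, K, compose (carrier (sec_quot G P K)) \<alpha> \<theta>))"

text \<open>
  \<open>Aut(U)\<close> with \<open>\<alpha>\<beta>\<close> meaning first \<open>\<alpha>\<close>, then \<open>\<beta>\<close>: the opposite of the library's group.
\<close>

definition Aut :: "('u, 'n) monoid_scheme \<Rightarrow> ('u \<Rightarrow> 'u) monoid"
  where "Aut U = (AutoGroup U)\<lparr>mult := (\<lambda>\<alpha> \<beta>. \<beta> \<otimes>\<^bsub>AutoGroup U\<^esub> \<alpha>)\<rparr>"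

definition umor_biset ::
  "('a, 'm) monoid_scheme \<Rightarrow> ('u, 'n) monoid_scheme \<Rightarrow> ('a, 'u \<Rightarrow> 'u, ('a, 'u) umor) biset"
  where "umor_biset G U =
    \<lparr>bset = U_morphisms G U,
     lact = (\<lambda>a \<theta>. umor_conj G \<theta> (inv\<^bsub>G\<^esub> a)),
     ract = umor_aut G\<rparr>"


section \<open>\<open>U\<close>-subgroups of a direct product\<close>

definition section_graph ::
  "('a, 'm) monoid_scheme \<Rightarrow> ('b, 'n) monoid_scheme \<Rightarrow> 'a set \<Rightarrow> 'a set \<Rightarrow> 'b set \<Rightarrow> 'b set
    \<Rightarrow> ('a set \<Rightarrow> 'b set) \<Rightarrow> ('a \<times> 'b) set"
  where "section_graph G1 G2 P1 K1 P2 K2 \<theta> =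
    {(a1, a2) \<in> P1 \<times> P2. \<theta> (K1 #>\<^bsub>G1\<^esub> a1) = K2 #>\<^bsub>G2\<^esub> a2}"

definition U_subgroups ::
  "('a, 'm) monoid_scheme \<Rightarrow> ('b, 'n) monoid_scheme \<Rightarrow> ('u, 'k) monoid_scheme \<Rightarrow> ('a \<times> 'b) set set"
  where "U_subgroups G1 G2 U = {L. subgroup L (G1 \<times>\<times> G2) \<and>
    (\<exists>P1 K1 P2 K2 \<theta>. is_section G1 P1 K1 \<and> is_section G2 P2 K2 \<and>
      \<theta> \<in> iso (sec_quot G1 P1 K1) (sec_quot G2 P2 K2) \<and>
      L = section_graph G1 G2 P1 K1 P2 K2 \<theta> \<and>
      sec_quot G1 P1 K1 \<cong> U \<and> sec_quot G2 P2 K2 \<cong> U)}"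

definition usub_biset ::
  "('a, 'm) monoid_scheme \<Rightarrow> ('b, 'n) monoid_scheme \<Rightarrow> ('u, 'k) monoid_scheme
    \<Rightarrow> ('a, 'b, ('a \<times> 'b) set) biset"
  where "usub_biset G1 G2 U =
    \<lparr>bset = U_subgroups G1 G2 U,
     lact = (\<lambda>a1 L. conj_set (G1 \<times>\<times> G2) (inv\<^bsub>G1\<^esub> a1, \<one>\<^bsub>G2\<^esub>) L),
     ract = (\<lambda>L a2. conj_set (G1 \<times>\<times> G2) (\<one>\<^bsub>G1\<^esub>, a2) L)\<rparr>"

text \<open>
  \<open>\<Pi>(\<theta>\<^sub>1, \<theta>\<^sub>2)\<close> is the graph of \<open>\<theta>\<^sub>1\<theta>\<^sub>2\<^sup>-\<^sup>1: P\<^sub>1/K\<^sub>1 \<rightarrow> P\<^sub>2/K\<^sub>2\<close>, that is, of \<open>\<theta>\<^sub>1\<close> followed by \<open>\<theta>\<^sub>2\<^sup>-\<^sup>1\<close>.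
\<close>

definition umor_Pi ::
  "('a, 'm) monoid_scheme \<Rightarrow> ('b, 'n) monoid_scheme \<Rightarrow> ('a, 'u) umor \<Rightarrow> ('b, 'u) umor
    \<Rightarrow> ('a \<times> 'b) set"
  where "umor_Pi G1 G2 = (\<lambda>(P1, K1, \<theta>1) (P2, K2, \<theta>2).
    section_graph G1 G2 P1 K1 P2 K2
      (compose (carrier (sec_quot G1 P1 K1)) (inv_into (carrier (sec_quot G2 P2 K2)) \<theta>2) \<theta>1))"

end

theory Submission
  imports Defs
begin

text \<open>
  A morphism \<open>\<theta>: P/K \<rightarrow> U\<close> is determined by the composite \<open>\<phi>: P \<rightarrow> P/K \<rightarrow> U\<close>, a homomorphism
  onto \<open>U\<close> with kernel \<open>K\<close>. In these terms \<open>\<Pi>(\<theta>\<^sub>1, \<theta>\<^sub>2)\<close> is the fibre product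
  \<open>{(a, b). \<phi>\<^sub>1 a = \<phi>\<^sub>2 b}\<close>, which makes its compatibility with the actions visible. Every
  isomorphism \<open>P\<^sub>1/K\<^sub>1 \<rightarrow> P\<^sub>2/K\<^sub>2\<close> of sections isomorphic to \<open>U\<close> factors through \<open>U\<close>, so \<open>\<Pi>\<close> is
  onto, and two factorizations of the same isomorphism differ by an automorphism of \<open>U\<close>, so the
  fibres of \<open>\<Pi>\<close> are the \<open>Aut(U)\<close>-orbits.
\<close>


section \<open>Tensor products of bisets\<close>

lemma biset_opposite:
  assumes "biset A B Y"
  shows "biset B A (opposite_biset A B Y)"
proof -
  interpret biset A B Y by fact
  show ?thesis
    by unfold_locales
      (auto simp: opposite_biset_def lact_closed ract_closed lact_one ract_one acts_commute
        A.inv_mult_group B.inv_mult_group lact_mult[symmetric] ract_mult[symmetric])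
qed

locale tensor_bisets = X: biset A B X + Y: biset B C Y
  for A :: "('a, 'm) monoid_scheme" and B :: "('b, 'n) monoid_scheme"
    and C :: "('c, 'k) monoid_scheme"
    and X :: "('a, 'b, 'x) biset" and Y :: "('b, 'c, 'y) biset"
begin

section \<open>Orbits of the middle action\<close>

abbreviation middle_orbit :: "'x \<times> 'y \<Rightarrow> ('x \<times> 'y) set"
  where "middle_orbit \<equiv> orbit B (middle_act B X Y)"

lemma middle_orbit_pair:
  "middle_orbit (x, y) = {(ract X x b, lact Y (inv\<^bsub>B\<^esub> b) y) | b. b \<in> carrier B}"
  by (simp add: orbit_def middle_act_def)

lemma middle_orbit_refl:
  assumes "x \<in> bset X" "y \<in> bset Y"
  shows "(x, y) \<in> middle_orbit (x, y)"
proof -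
  have "(x, y) = (ract X x \<one>\<^bsub>B\<^esub>, lact Y (inv\<^bsub>B\<^esub> \<one>\<^bsub>B\<^esub>) y)"
    using assms by (simp add: X.ract_one Y.lact_one)
  then show ?thesis
    unfolding middle_orbit_pair by blast
qed

text \<open>Acting by \<open>c\<close> after \<open>b\<close> is acting by the product
  \<open>b c\<close>, so every translate of the shifted pair is a translate of
  \<open>(x, y)\<close>; conversely, \<open>inv b\<close> times \<open>c\<close> leads from the
  shifted pair to the \<open>c\<close>-translate of \<open>(x, y)\<close>.\<close>

lemma middle_orbit_shift:
  assumes "x \<in> bset X" "y \<in> bset Y" and b: "b \<in> carrier B"
  shows "middle_orbit (ract X x b, lact Y (inv\<^bsub>B\<^esub> b) y) = middle_orbit (x, y)" (is "?L = ?R")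
proof
  have "(ract X (ract X x b) c, lact Y (inv\<^bsub>B\<^esub> c) (lact Y (inv\<^bsub>B\<^esub> b) y)) \<in> ?R"
    if "c \<in> carrier B" for c
  proof -
    have "b \<otimes>\<^bsub>B\<^esub> c \<in> carrier B"
      "ract X (ract X x b) c = ract X x (b \<otimes>\<^bsub>B\<^esub> c)"
      "lact Y (inv\<^bsub>B\<^esub> c) (lact Y (inv\<^bsub>B\<^esub> b) y) = lact Y (inv\<^bsub>B\<^esub> (b \<otimes>\<^bsub>B\<^esub> c)) y"
      using assms that by (simp_all add: X.ract_mult Y.lact_mult X.B.inv_mult_group)
    then show ?thesis
      unfolding middle_orbit_pair by blast
  qed
  then show "?L \<subseteq> ?R"
    unfolding middle_orbit_pair by blast
  have "(ract X x c, lact Y (inv\<^bsub>B\<^esub> c) y) \<in> ?L" if c: "c \<in> carrier B" for c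
  proof -
    let ?d = "inv\<^bsub>B\<^esub> b \<otimes>\<^bsub>B\<^esub> c"
    have eq: "b \<otimes>\<^bsub>B\<^esub> ?d = c"
      using b c by (simp add: X.B.m_assoc[symmetric])
    have "?d \<in> carrier B"
      "ract X (ract X x b) ?d = ract X x c"
      "lact Y (inv\<^bsub>B\<^esub> ?d) (lact Y (inv\<^bsub>B\<^esub> b) y) = lact Y (inv\<^bsub>B\<^esub> c) y"
      using assms c eq by (simp_all add: X.ract_mult[symmetric] Y.lact_mult[symmetric]
          X.B.inv_mult_group[symmetric])
    then show ?thesis
      unfolding middle_orbit_pair by (smt (verit) mem_Collect_eq)
  qed
  then show "?R \<subseteq> ?L"
    unfolding middle_orbit_pair[of x y] by blast
qed

lemma middle_orbit_eq_iff:
  assumes "x \<in> bset X" "y \<in> bset Y" "x' \<in> bset X" "y' \<in> bset Y"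
  shows "middle_orbit (x, y) = middle_orbit (x', y') \<longleftrightarrow>
    (\<exists>b \<in> carrier B. x' = ract X x b \<and> y' = lact Y (inv\<^bsub>B\<^esub> b) y)"
proof
  assume "middle_orbit (x, y) = middle_orbit (x', y')"
  then have "(x', y') \<in> middle_orbit (x, y)"
    using middle_orbit_refl assms by simp
  then show "\<exists>b \<in> carrier B. x' = ract X x b \<and> y' = lact Y (inv\<^bsub>B\<^esub> b) y"
    by (auto simp: middle_orbit_pair)
qed (use assms middle_orbit_shift in auto)

section \<open>The tensor product computed on representatives\<close>

lemma bset_tensor: "bset (tensor_biset B X Y) = middle_orbit ` (bset X \<times> bset Y)"
  by (auto simp: tensor_biset_def orbits_def)

lemma tensorE:
  assumes "Z \<in> bset (tensor_biset B X Y)"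
  obtains x y where "x \<in> bset X" "y \<in> bset Y" "Z = middle_orbit (x, y)"
  using assms by (auto simp: bset_tensor)

text \<open>The outer action moves all pairs of an orbit at once. Since the two actions on
  \<open>X\<close> commute, the image is again a full orbit, so no choice of representative has to
  be justified.\<close>

lemma lact_tensor:
  assumes "a \<in> carrier A" "x \<in> bset X" "y \<in> bset Y"
  shows "lact (tensor_biset B X Y) a (middle_orbit (x, y)) = middle_orbit (lact X a x, y)"
  using assms
  by (simp add: tensor_biset_def middle_orbit_pair Setcompr_eq_image image_image X.acts_commute
      cong: image_cong)

lemma ract_tensor:
  assumes "c \<in> carrier C" "x \<in> bset X" "y \<in> bset Y"
  shows "ract (tensor_biset B X Y) (middle_orbit (x, y)) c = middle_orbit (x, ract Y y c)"
  using assms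
  by (simp add: tensor_biset_def middle_orbit_pair Setcompr_eq_image image_image Y.acts_commute
      cong: image_cong)

lemma middle_orbit_in_tensor:
  "x \<in> bset X \<Longrightarrow> y \<in> bset Y \<Longrightarrow> middle_orbit (x, y) \<in> bset (tensor_biset B X Y)"
  by (auto simp: bset_tensor)

lemma biset_tensor: "biset A C (tensor_biset B X Y)"
  by unfold_locales
    (auto elim!: tensorE simp: lact_tensor ract_tensor middle_orbit_in_tensor
      X.lact_closed Y.ract_closed X.lact_one Y.ract_one X.lact_mult Y.ract_mult)

text \<open>Reduces an isomorphism out of a tensor product to properties of a map \<open>F\<close>
  on pairs: its fibres are exactly the middle orbits, it is onto, and it respects the outer action
  on each side. It will be applied to \<Pi>.\<close>

lemma tensor_induced_iso:
  fixes S :: "('a, 'c, 's) biset" and F :: "'x \<Rightarrow> 'y \<Rightarrow> 's"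
  assumes S: "biset A C S"
    and onto: "(\<lambda>(x, y). F x y) ` (bset X \<times> bset Y) = bset S"
    and fibres: "\<And>x y x' y'. \<lbrakk>x \<in> bset X; y \<in> bset Y; x' \<in> bset X; y' \<in> bset Y\<rbrakk> \<Longrightarrow>
      F x y = F x' y' \<longleftrightarrow> (\<exists>b \<in> carrier B. x' = ract X x b \<and> y' = lact Y (inv\<^bsub>B\<^esub> b) y)"
    and left: "\<And>a x y. \<lbrakk>a \<in> carrier A; x \<in> bset X; y \<in> bset Y\<rbrakk> \<Longrightarrow>
      F (lact X a x) y = lact S a (F x y)"
    and right: "\<And>c x y. \<lbrakk>c \<in> carrier C; x \<in> bset X; y \<in> bset Y\<rbrakk> \<Longrightarrow>
      F x (ract Y y c) = ract S (F x y) c"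
  shows "\<exists>f \<in> biset_iso A C (tensor_biset B X Y) S.
    \<forall>x \<in> bset X. \<forall>y \<in> bset Y. f (middle_orbit (x, y)) = F x y"
proof -
  \<comment> \<open>On an orbit \<open>F\<close> is constant by \<open>fibres\<close>, so its image
    there is a singleton and \<open>the_elem\<close> picks the common value.\<close>
  define f where "f Z = the_elem ((\<lambda>(x, y). F x y) ` Z)" for Z
  have f: "f (middle_orbit (x, y)) = F x y" if "x \<in> bset X" "y \<in> bset Y" for x y
  proof -
    have "F (ract X x b) (lact Y (inv\<^bsub>B\<^esub> b) y) = F x y" if "b \<in> carrier B" for b
      using that \<open>x \<in> bset X\<close> \<open>y \<in> bset Y\<close> fibres X.ract_closed Y.lact_closed X.B.inv_closed
      by metis
    then have "(\<lambda>(x, y). F x y) ` middle_orbit (x, y) = {F x y}"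
      using middle_orbit_refl[OF that] by (force simp: middle_orbit_pair)
    then show ?thesis
      by (simp add: f_def)
  qed
  have "inj_on f (bset (tensor_biset B X Y))"
    by (rule inj_onI) (auto elim!: tensorE simp: f fibres middle_orbit_shift)
  moreover have "f ` bset (tensor_biset B X Y) = bset S"
    using onto by (force simp: bset_tensor image_image f)
  ultimately have "f \<in> biset_iso A C (tensor_biset B X Y) S"
    using S biset_tensor
    by (auto simp: biset_iso_def bij_betw_def lact_tensor ract_tensor f left right
        X.lact_closed Y.ract_closed elim!: tensorE)
  then show ?thesis
    using f by blast
qed

end


section \<open>Sections and homomorphisms onto \<open>U\<close>\<close>

text \<open>The first isomorphism theorem, read in both directions. The single equation K = kernel
  encodes two facts: K is normal, being a kernel, and \<theta> is injective on cosets, since equal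
  values at Kx and Ky put x times the inverse of y into K.\<close>

lemma (in group) normal_iso_Mod_iff:
  assumes "group H"
  shows "K \<lhd> G \<and> \<theta> \<in> iso (G Mod K) H \<longleftrightarrow>
    (\<lambda>x. \<theta> (K #> x)) \<in> hom G H \<and> (\<lambda>x. \<theta> (K #> x)) ` carrier G = carrier H \<and>
    K = kernel G H (\<lambda>x. \<theta> (K #> x))" (is "?L \<longleftrightarrow> ?R")
proof
  assume ?L
  then interpret K: normal K G by simp
  have \<theta>: "\<theta> \<in> hom (G Mod K) H" "inj_on \<theta> (carrier (G Mod K))" "\<theta> ` carrier (G Mod K) = carrier H"
    using \<open>?L\<close> by (auto simp: iso_def bij_betw_def)
  interpret \<theta>: group_hom "G Mod K" H \<theta>
    using \<theta>(1) assms K.factorgroup_is_group by (simp add: group_hom_def group_hom_axioms_def)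
  have "\<theta> \<circ> (\<lambda>x. K #> x) \<in> hom G H"
    using K.r_coset_hom_Mod \<theta>(1) by (rule Group.hom_compose)
  moreover have "x \<in> K \<longleftrightarrow> x \<in> carrier G \<and> \<theta> (K #> x) = \<one>\<^bsub>H\<^esub>" for x
  proof -
    have "\<theta> (K #> x) = \<one>\<^bsub>H\<^esub> \<longleftrightarrow> K #> x = K" if "x \<in> carrier G"
    proof -
      have "\<theta> K = \<one>\<^bsub>H\<^esub>" "K \<in> carrier (G Mod K)" "K #> x \<in> carrier (G Mod K)"
        using \<theta>.hom_one \<theta>.G.one_closed that by (simp_all add: carrier_FactGroup)
      then show ?thesis
        using \<theta>(2) by (metis inj_onD)
    qed
    then show ?thesis
      using coset_join1[OF _ _ K.subgroup_axioms] K.rcos_const[OF is_group] K.mem_carrier by blast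
  qed
  then have "K = kernel G H (\<lambda>x. \<theta> (K #> x))"
    unfolding kernel_def by blast
  ultimately show ?R
    using \<theta>(3) by (simp add: o_def carrier_FactGroup image_image)
next
  assume R: ?R
  let ?\<phi> = "\<lambda>x. \<theta> (K #> x)"
  have \<phi>: "?\<phi> \<in> hom G H" "?\<phi> ` carrier G = carrier H"
    and K: "kernel G H ?\<phi> = K"
    using R by blast+
  interpret \<phi>: group_hom G H ?\<phi>
    using \<phi>(1) assms by (simp add: group_hom_def group_hom_axioms_def)
  interpret K: normal K G
    using \<phi>.normal_kernel unfolding K .
  have "\<theta> \<in> hom (G Mod K) H"
    by (auto simp: hom_def carrier_FactGroup K.rcos_sum \<phi>.hom_mult)
  moreover have "inj_on \<theta> (carrier (G Mod K))"
  proof (rule inj_onI, unfold carrier_FactGroup, clarify)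
    fix x y assume xy: "x \<in> carrier G" "y \<in> carrier G" "\<theta> (K #> x) = \<theta> (K #> y)"
    then have "?\<phi> (x \<otimes> inv y) = \<one>\<^bsub>H\<^esub>"
      by (subst \<phi>.hom_mult) (auto simp: \<phi>.hom_inv)
    then have "x \<otimes> inv y \<in> kernel G H ?\<phi>"
      using xy by (simp add: kernel_def)
    then have "x \<in> K #> y"
      unfolding K using xy by (intro K.rcos_module_rev[OF is_group])
    then show "K #> x = K #> y"
      using repr_independence[OF _ _ K.subgroup_axioms] xy by simp
  qed
  ultimately show ?L
    using \<phi>(2) K.normal_axioms by (simp add: iso_def bij_betw_def carrier_FactGroup image_image)
qed

lemma carrier_sec_quot: "carrier (sec_quot G P K) = (\<lambda>x. K #>\<^bsub>G\<^esub> x) ` P"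
  by (auto simp: sec_quot_def carrier_FactGroup r_coset_def)

text \<open>This is the composite \<phi> of the projection P \<rightarrow> P/K with \<theta>. Only
  its values on P are meaningful.\<close>

definition umor_hom :: "('a, 'm) monoid_scheme \<Rightarrow> ('a, 'u) umor \<Rightarrow> 'a \<Rightarrow> 'u"
  where "umor_hom G = (\<lambda>(P, K, \<theta>) x. \<theta> (K #>\<^bsub>G\<^esub> x))"

text \<open>Membership becomes a condition on \<phi>: homomorphism, image and kernel. Closure under
  the two actions can then be checked without handling quotient groups.\<close>

lemma U_morphisms_iff:
  assumes "group G" "group U"
  shows "(P, K, \<theta>) \<in> U_morphisms G U \<longleftrightarrow> subgroup P G \<and>
    \<theta> \<in> extensional ((\<lambda>x. K #>\<^bsub>G\<^esub> x) ` P) \<and>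
    umor_hom G (P, K, \<theta>) \<in> hom (G\<lparr>carrier := P\<rparr>) U \<and>
    umor_hom G (P, K, \<theta>) ` P = carrier U \<and>
    K = kernel (G\<lparr>carrier := P\<rparr>) U (umor_hom G (P, K, \<theta>))"
proof (cases "subgroup P G")
  case True
  interpret P: group "G\<lparr>carrier := P\<rparr>"
    using assms True by (simp add: group.subgroup_imp_group)
  \<comment> \<open>A coset depends only on the multiplication, so it is the same in P as in
    G.\<close>
  have "K #>\<^bsub>G\<lparr>carrier := P\<rparr>\<^esub> x = K #>\<^bsub>G\<^esub> x" for x
    by (simp add: r_coset_def)
  with P.normal_iso_Mod_iff[OF assms(2), of K \<theta>] True show ?thesis
    by (auto simp: U_morphisms_def is_section_def carrier_sec_quot[unfolded sec_quot_def]
        umor_hom_def sec_quot_def)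
qed (simp add: U_morphisms_def is_section_def)

section \<open>A morphism seen through its homomorphism \<phi>\<close>

context
  fixes G :: "('a, 'm) monoid_scheme" and U :: "('u, 'n) monoid_scheme"
  assumes G: "group G" and U: "group U"
begin

interpretation G: group G by (rule G)
interpretation U: group U by (rule U)

context
  fixes m assumes m: "m \<in> U_morphisms G U"
begin

lemma umor_subgroup: "subgroup (fst m) G"
  using m U_morphisms_iff[OF G U] by (cases m) auto

lemma umor_subset: "x \<in> fst m \<Longrightarrow> x \<in> carrier G"
  using umor_subgroup subgroup.mem_carrier by metis

lemma umor_hom_in_hom: "umor_hom G m \<in> hom (G\<lparr>carrier := fst m\<rparr>) U"
  using m U_morphisms_iff[OF G U] by (cases m) auto

lemma umor_hom_closed: "x \<in> fst m \<Longrightarrow> umor_hom G m x \<in> carrier U"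
  using umor_hom_in_hom by (auto simp: hom_def)

lemma umor_hom_mult:
  "x \<in> fst m \<Longrightarrow> y \<in> fst m \<Longrightarrow> umor_hom G m (x \<otimes>\<^bsub>G\<^esub> y) = umor_hom G m x \<otimes>\<^bsub>U\<^esub> umor_hom G m y"
  using umor_hom_in_hom by (auto simp: hom_def)

lemma umor_hom_image: "umor_hom G m ` fst m = carrier U"
  using m U_morphisms_iff[OF G U] by (cases m) auto

lemma umor_hom_preimage:
  assumes "u \<in> carrier U"
  obtains x where "x \<in> fst m" "umor_hom G m x = u"
  using assms umor_hom_image by (metis imageE)

lemma umor_kernel: "fst (snd m) = {x \<in> fst m. umor_hom G m x = \<one>\<^bsub>U\<^esub>}"
proof -
  obtain P K \<theta> where "m = (P, K, \<theta>)"
    by (cases m)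
  moreover then have "K = kernel (G\<lparr>carrier := P\<rparr>) U (umor_hom G (P, K, \<theta>))"
    using m U_morphisms_iff[OF G U] by blast
  ultimately show ?thesis
    by (simp add: kernel_def)
qed

lemma umor_hom_one: "umor_hom G m \<one>\<^bsub>G\<^esub> = \<one>\<^bsub>U\<^esub>"
proof -
  interpret P: group "G\<lparr>carrier := fst m\<rparr>"
    using umor_subgroup by (rule G.subgroup_imp_group)
  interpret group_hom "G\<lparr>carrier := fst m\<rparr>" U "umor_hom G m"
    using umor_hom_in_hom by (simp add: group_hom_def group_hom_axioms_def P.is_group U)
  show ?thesis
    using hom_one by simp
qed

lemma umor_hom_inv: "x \<in> fst m \<Longrightarrow> umor_hom G m (inv\<^bsub>G\<^esub> x) = inv\<^bsub>U\<^esub> (umor_hom G m x)"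
  using umor_hom_mult[of "inv\<^bsub>G\<^esub> x" x] umor_hom_one umor_subset umor_hom_closed
    subgroup.m_inv_closed[OF umor_subgroup] by (simp add: U.inv_equality)

end

text \<open>The whole triple can be recovered from P and \<phi>: K is the kernel, and \<theta> is
  fixed on the cosets by \<phi> and elsewhere by extensionality. Identities between morphisms are
  proved below by comparing domains and values of \<phi>.\<close>

lemma umor_eqI:
  assumes m: "m \<in> U_morphisms G U" "m' \<in> U_morphisms G U"
    and "fst m = fst m'" "\<And>x. x \<in> fst m \<Longrightarrow> umor_hom G m x = umor_hom G m' x"
  shows "m = m'"
proof -
  obtain P K \<theta> K' \<theta>' where eq: "m = (P, K, \<theta>)" "m' = (P, K', \<theta>')"
    using assms(3) by (cases m; cases m') auto
  have "fst (snd m) = fst (snd m')"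
    unfolding umor_kernel[OF m(1)] umor_kernel[OF m(2)] using assms(3,4) by auto
  then have "K = K'"
    by (simp add: eq)
  moreover have "\<theta> = \<theta>'"
  proof (rule extensionalityI)
    show "\<theta> \<in> extensional ((\<lambda>x. K #>\<^bsub>G\<^esub> x) ` P)" "\<theta>' \<in> extensional ((\<lambda>x. K #>\<^bsub>G\<^esub> x) ` P)"
      using m by (simp_all add: eq U_morphisms_iff[OF G U] \<open>K = K'\<close>)
  qed (use assms(4) in \<open>auto simp: eq umor_hom_def \<open>K = K'\<close>\<close>)
  ultimately show ?thesis
    by (simp add: eq)
qed

end


section \<open>Conjugation and automorphisms\<close>

context group
begin

lemma conj_mult:
  assumes "a \<in> carrier G" "x \<in> carrier G" "y \<in> carrier G"
  shows "inv a \<otimes> (x \<otimes> y) \<otimes> a = (inv a \<otimes> x \<otimes> a) \<otimes> (inv a \<otimes> y \<otimes> a)"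
proof -
  have "a \<otimes> (inv a \<otimes> (y \<otimes> a)) = y \<otimes> a"
    using assms by (simp add: m_assoc[symmetric])
  then show ?thesis
    using assms by (simp add: m_assoc)
qed

lemma conj_inv:
  assumes "a \<in> carrier G" "x \<in> carrier G"
  shows "inv a \<otimes> inv x \<otimes> a = inv (inv a \<otimes> x \<otimes> a)"
  using assms by (simp add: inv_mult_group m_assoc)

lemma conj_set_conj_set:
  assumes "a \<in> carrier G" "b \<in> carrier G" "S \<subseteq> carrier G"
  shows "conj_set G a (conj_set G b S) = conj_set G (b \<otimes> a) S"
  unfolding conj_set_def image_image
  using assms by (intro image_cong) (auto simp: inv_mult_group m_assoc subset_iff)

lemma conj_set_one:
  assumes "S \<subseteq> carrier G"
  shows "conj_set G \<one> S = S"
proof -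
  have "inv \<one> \<otimes> x \<otimes> \<one> = x" if "x \<in> S" for x
    using assms that by (simp add: subset_iff)
  then show ?thesis
    by (simp add: conj_set_def)
qed

text \<open>Conjugation by \<open>inv a\<close> undoes it. Working on all subsets covers the cosets
  of a section, where this makes the \<open>inv_into\<close> of \<open>umor_conj\<close> a genuine
  inverse of \<gamma>.\<close>

lemma inj_on_conj_set:
  assumes "a \<in> carrier G"
  shows "inj_on (conj_set G a) (Pow (carrier G))"
proof (rule inj_on_inverseI)
  fix S assume "S \<in> Pow (carrier G)"
  then show "conj_set G (inv a) (conj_set G a S) = S"
    using assms by (simp add: conj_set_conj_set conj_set_one)
qed

lemma conj_set_r_coset:
  assumes "a \<in> carrier G" "x \<in> carrier G" "K \<subseteq> carrier G"
  shows "conj_set G a (K #> x) = conj_set G a K #> (inv a \<otimes> x \<otimes> a)"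
proof -
  have "inv a \<otimes> (k \<otimes> x) \<otimes> a = (inv a \<otimes> k \<otimes> a) \<otimes> (inv a \<otimes> x \<otimes> a)" if "k \<in> K" for k
    using assms that by (intro conj_mult) auto
  then show ?thesis
    by (simp add: conj_set_def r_coset_def UNION_singleton_eq_range image_image cong: image_cong)
qed

lemma subgroup_conj_set:
  assumes a: "a \<in> carrier G" and "subgroup P G"
  shows "subgroup (conj_set G a P) G"
proof -
  interpret P: subgroup P G by fact
  show ?thesis
  proof
    have "\<one> = inv a \<otimes> \<one> \<otimes> a"
      using a by simp
    then show "\<one> \<in> conj_set G a P"
      unfolding conj_set_def by (rule image_eqI) simp
    show "x \<otimes> y \<in> conj_set G a P" if xy: "x \<in> conj_set G a P" "y \<in> conj_set G a P" for x y
    proof -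
      obtain x' y' where "x' \<in> P" "x = inv a \<otimes> x' \<otimes> a" "y' \<in> P" "y = inv a \<otimes> y' \<otimes> a"
        using xy by (auto simp: conj_set_def)
      then have "x \<otimes> y = inv a \<otimes> (x' \<otimes> y') \<otimes> a" "x' \<otimes> y' \<in> P"
        using a by (simp_all only: conj_mult P.mem_carrier P.m_closed)
      then show ?thesis
        unfolding conj_set_def by blast
    qed
    show "inv x \<in> conj_set G a P" if x: "x \<in> conj_set G a P" for x
    proof -
      obtain x' where "x' \<in> P" "x = inv a \<otimes> x' \<otimes> a"
        using x by (auto simp: conj_set_def)
      then have "inv x = inv a \<otimes> inv x' \<otimes> a" "inv x' \<in> P"
        using a by (simp_all only: conj_inv P.mem_carrier P.m_inv_closed)
      then show ?thesis
        unfolding conj_set_def by blast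
    qed
  qed (use a in \<open>auto simp: conj_set_def\<close>)
qed

end

section \<open>The automorphism group and the two actions on morphisms\<close>

lemma fst_umor_conj: "fst (umor_conj G m a) = conj_set G a (fst m)"
  by (simp add: umor_conj_def split: prod.split)

lemma fst_umor_aut: "fst (umor_aut G m \<alpha>) = fst m"
  by (simp add: umor_aut_def split: prod.split)

lemma umor_hom_aut: "x \<in> fst m \<Longrightarrow> umor_hom G (umor_aut G m \<alpha>) x = \<alpha> (umor_hom G m x)"
  by (cases m) (auto simp: umor_aut_def umor_hom_def carrier_sec_quot compose_def)

lemma group_Aut:
  assumes "group U"
  shows "group (Aut U)"
proof -
  interpret A: group "AutoGroup U"
    using assms by (rule group.AutoGroup)
  show ?thesis
    \<comment> \<open>\<open>groupI\<close> asks for left inverses; in the reversed product these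
      are right inverses of \<open>AutoGroup U\<close>.\<close>
    by (rule groupI) (auto simp: Aut_def A.m_assoc intro: A.r_inv_ex)
qed

lemma carrier_Aut: "carrier (Aut U) = hom U U \<inter> Bij (carrier U)"
  by (simp add: Aut_def AutoGroup_def auto_def)

lemma one_Aut: "\<one>\<^bsub>Aut U\<^esub> = (\<lambda>u \<in> carrier U. u)"
  by (simp add: Aut_def AutoGroup_def BijGroup_def)

lemma mult_Aut:
  "\<lbrakk>\<alpha> \<in> carrier (Aut U); \<beta> \<in> carrier (Aut U)\<rbrakk> \<Longrightarrow> \<alpha> \<otimes>\<^bsub>Aut U\<^esub> \<beta> = compose (carrier U) \<beta> \<alpha>"
  by (simp add: Aut_def AutoGroup_def BijGroup_def auto_def)

context
  fixes G :: "('a, 'm) monoid_scheme" and U :: "('u, 'n) monoid_scheme"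
  assumes G: "group G" and U: "group U"
begin

interpretation G: group G by (rule G)
interpretation U: group U by (rule U)

text \<open>\<gamma> takes the coset of x to the coset of its conjugate, and the definition of
  \<open>umor_conj\<close> applies the inverse of \<gamma> before \<theta>. This formula carries all
  later reasoning about the conjugation action.\<close>

lemma umor_hom_conj:
  assumes m: "m \<in> U_morphisms G U" and a: "a \<in> carrier G" and x: "x \<in> fst m"
  shows "umor_hom G (umor_conj G m a) (inv\<^bsub>G\<^esub> a \<otimes>\<^bsub>G\<^esub> x \<otimes>\<^bsub>G\<^esub> a) = umor_hom G m x"
proof -
  obtain P K \<theta> where eq: "m = (P, K, \<theta>)"
    by (cases m)
  let ?C = "carrier (sec_quot G P K)"
  have P: "P \<subseteq> carrier G" and K: "K \<subseteq> carrier G"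
    using umor_subset[OF G U m] umor_kernel[OF G U m] by (auto simp: eq)
  then have "?C \<subseteq> Pow (carrier G)"
    by (auto simp: carrier_sec_quot r_coset_def)
  then have "inj_on (conj_set G a) ?C"
    using G.inj_on_conj_set[OF a] inj_on_subset by blast
  moreover have "K #>\<^bsub>G\<^esub> x \<in> ?C"
    using x by (auto simp: eq carrier_sec_quot)
  ultimately have inv: "inv_into ?C (conj_set G a) (conj_set G a (K #>\<^bsub>G\<^esub> x)) = K #>\<^bsub>G\<^esub> x"
    by (rule inv_into_f_f)
  have coset: "conj_set G a (K #>\<^bsub>G\<^esub> x) = conj_set G a K #>\<^bsub>G\<^esub> (inv\<^bsub>G\<^esub> a \<otimes>\<^bsub>G\<^esub> x \<otimes>\<^bsub>G\<^esub> a)"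
    using a x P K by (intro G.conj_set_r_coset) (auto simp: eq)
  \<comment> \<open>\<open>compose\<close> has the intended value only on the carrier of the
    conjugated quotient, so the coset must be shown to lie there.\<close>
  have "conj_set G a K #>\<^bsub>G\<^esub> (inv\<^bsub>G\<^esub> a \<otimes>\<^bsub>G\<^esub> x \<otimes>\<^bsub>G\<^esub> a)
    \<in> carrier (sec_quot G (conj_set G a P) (conj_set G a K))"
    using x by (auto simp: eq carrier_sec_quot conj_set_def[of G a P])
  then show ?thesis
    using inv by (simp add: eq umor_hom_def umor_conj_def compose_def coset)
qed

text \<open>The new \<phi> takes at a conjugate the old value, so homomorphism, image and kernel all
  transfer; normality of the conjugated K comes with the kernel condition.\<close>

lemma umor_conj_closed:
  assumes m: "m \<in> U_morphisms G U" and a: "a \<in> carrier G"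
  shows "umor_conj G m a \<in> U_morphisms G U"
proof -
  obtain P K \<theta> where eq: "m = (P, K, \<theta>)"
    by (cases m)
  let ?P = "conj_set G a P" and ?K = "conj_set G a K"
  obtain \<theta>' where eq': "umor_conj G m a = (?P, ?K, \<theta>')"
    and ext: "\<theta>' \<in> extensional ((\<lambda>x. ?K #>\<^bsub>G\<^esub> x) ` ?P)"
    by (simp add: umor_conj_def eq carrier_sec_quot[of G ?P])
  let ?\<phi> = "umor_hom G (?P, ?K, \<theta>')"
  have P: "subgroup P G"
    using umor_subgroup[OF G U m] by (simp add: eq)
  then interpret P: subgroup P G .
  have \<phi>: "?\<phi> (inv\<^bsub>G\<^esub> a \<otimes>\<^bsub>G\<^esub> x \<otimes>\<^bsub>G\<^esub> a) = umor_hom G m x" if "x \<in> P" for x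
    using umor_hom_conj[OF m a, of x] that eq by (simp flip: eq')
  have "?\<phi> \<in> hom (G\<lparr>carrier := ?P\<rparr>) U"
  proof (rule homI)
    fix x y assume "x \<in> carrier (G\<lparr>carrier := ?P\<rparr>)" "y \<in> carrier (G\<lparr>carrier := ?P\<rparr>)"
    then show "?\<phi> (x \<otimes>\<^bsub>G\<lparr>carrier := ?P\<rparr>\<^esub> y) = ?\<phi> x \<otimes>\<^bsub>U\<^esub> ?\<phi> y"
      using a umor_hom_mult[OF G U m]
      by (auto simp: conj_set_def G.conj_mult[symmetric] \<phi>[unfolded conj_set_def] eq)
  qed (use umor_hom_closed[OF G U m] in \<open>auto simp: eq conj_set_def \<phi>[unfolded conj_set_def]\<close>)
  moreover have "?\<phi> ` ?P = carrier U"
    using umor_hom_image[OF G U m] \<phi>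
    by (simp add: conj_set_def image_image eq cong: image_cong)
  moreover have "?K = kernel (G\<lparr>carrier := ?P\<rparr>) U ?\<phi>"
  proof -
    have "K = {x \<in> P. umor_hom G m x = \<one>\<^bsub>U\<^esub>}"
      using umor_kernel[OF G U m] by (simp add: eq)
    then have "?K = {y \<in> ?P. ?\<phi> y = \<one>\<^bsub>U\<^esub>}"
      using \<phi> by (auto simp: conj_set_def)
    then show ?thesis
      by (simp add: kernel_def)
  qed
  ultimately show ?thesis
    unfolding eq' U_morphisms_iff[OF G U]
    using ext G.subgroup_conj_set[OF a P] by blast
qed

text \<open>Following \<phi> by a bijective homomorphism of U preserves its image and its
  kernel.\<close>

lemma umor_aut_closed:
  assumes m: "m \<in> U_morphisms G U" and \<alpha>: "\<alpha> \<in> carrier (Aut U)"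
  shows "umor_aut G m \<alpha> \<in> U_morphisms G U"
proof -
  obtain P K \<theta> where eq: "m = (P, K, \<theta>)"
    by (cases m)
  obtain \<theta>' where eq': "umor_aut G m \<alpha> = (P, K, \<theta>')"
    and ext: "\<theta>' \<in> extensional ((\<lambda>x. K #>\<^bsub>G\<^esub> x) ` P)"
    by (simp add: umor_aut_def eq carrier_sec_quot)
  let ?\<phi> = "umor_hom G (P, K, \<theta>')"
  have P: "subgroup P G"
    using umor_subgroup[OF G U m] by (simp add: eq)
  then interpret P: subgroup P G .
  interpret \<alpha>: group_hom U U \<alpha>
    using \<alpha> by (simp add: carrier_Aut group_hom_def group_hom_axioms_def U)
  have \<alpha>_bij: "inj_on \<alpha> (carrier U)" "\<alpha> ` carrier U = carrier U"
    using \<alpha> by (auto simp: carrier_Aut Bij_def bij_betw_def)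
  have \<phi>: "?\<phi> x = \<alpha> (umor_hom G m x)" if "x \<in> P" for x
    using umor_hom_aut[of x m G \<alpha>] that eq by (simp flip: eq')
  have closed: "umor_hom G m x \<in> carrier U" if "x \<in> P" for x
    using umor_hom_closed[OF G U m] that by (simp add: eq)
  have mult: "umor_hom G m (x \<otimes>\<^bsub>G\<^esub> y) = umor_hom G m x \<otimes>\<^bsub>U\<^esub> umor_hom G m y"
    if "x \<in> P" "y \<in> P" for x y
    using umor_hom_mult[OF G U m] that by (simp add: eq)
  have "?\<phi> \<in> hom (G\<lparr>carrier := P\<rparr>) U"
    by (intro homI) (simp_all add: \<phi> closed mult)
  moreover have "?\<phi> ` P = \<alpha> ` umor_hom G m ` P"
    using \<phi> by (simp add: image_image cong: image_cong)
  then have "?\<phi> ` P = carrier U"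
    using umor_hom_image[OF G U m] \<alpha>_bij by (simp add: eq)
  moreover have "K = kernel (G\<lparr>carrier := P\<rparr>) U ?\<phi>"
  proof -
    have "\<alpha> u = \<one>\<^bsub>U\<^esub> \<longleftrightarrow> u = \<one>\<^bsub>U\<^esub>" if "u \<in> carrier U" for u
      using \<alpha>_bij(1) that \<alpha>.hom_one inj_onD U.one_closed by metis
    then have "{x \<in> P. umor_hom G m x = \<one>\<^bsub>U\<^esub>} = {x \<in> P. ?\<phi> x = \<one>\<^bsub>U\<^esub>}"
      using \<phi> closed by auto
    moreover have "K = {x \<in> P. umor_hom G m x = \<one>\<^bsub>U\<^esub>}"
      using umor_kernel[OF G U m] by (simp add: eq)
    ultimately show ?thesis
      by (simp add: kernel_def)
  qed
  ultimately show ?thesis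
    unfolding eq' U_morphisms_iff[OF G U] using ext P by blast
qed

text \<open>Conjugation is a right action; the inverse in \<open>umor_biset\<close> turns it into
  the left action of G.\<close>

lemma umor_conj_conj:
  assumes m: "m \<in> U_morphisms G U" and ab: "a \<in> carrier G" "b \<in> carrier G"
  shows "umor_conj G (umor_conj G m a) b = umor_conj G m (a \<otimes>\<^bsub>G\<^esub> b)"
proof (rule umor_eqI[OF G U])
  have P: "fst m \<subseteq> carrier G"
    using umor_subset[OF G U m] by blast
  show "fst (umor_conj G (umor_conj G m a) b) = fst (umor_conj G m (a \<otimes>\<^bsub>G\<^esub> b))"
    using ab P by (simp add: fst_umor_conj G.conj_set_conj_set)
  fix x assume "x \<in> fst (umor_conj G (umor_conj G m a) b)"
  then obtain y where y: "y \<in> fst m"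
    and x: "x = inv\<^bsub>G\<^esub> b \<otimes>\<^bsub>G\<^esub> (inv\<^bsub>G\<^esub> a \<otimes>\<^bsub>G\<^esub> y \<otimes>\<^bsub>G\<^esub> a) \<otimes>\<^bsub>G\<^esub> b"
    by (auto simp: fst_umor_conj conj_set_def)
  have "x = inv\<^bsub>G\<^esub> (a \<otimes>\<^bsub>G\<^esub> b) \<otimes>\<^bsub>G\<^esub> y \<otimes>\<^bsub>G\<^esub> (a \<otimes>\<^bsub>G\<^esub> b)"
    using ab y P by (auto simp: x G.inv_mult_group G.m_assoc subset_iff)
  then have "umor_hom G (umor_conj G m (a \<otimes>\<^bsub>G\<^esub> b)) x = umor_hom G m y"
    using umor_hom_conj[OF m _ y] ab by simp
  moreover have "umor_hom G (umor_conj G (umor_conj G m a) b) x = umor_hom G m y"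
    unfolding x using y
    by (subst umor_hom_conj[OF umor_conj_closed[OF m ab(1)] ab(2)])
      (simp_all add: umor_hom_conj[OF m ab(1)] fst_umor_conj conj_set_def)
  ultimately show "umor_hom G (umor_conj G (umor_conj G m a) b) x
      = umor_hom G (umor_conj G m (a \<otimes>\<^bsub>G\<^esub> b)) x"
    by simp
qed (use assms in \<open>auto intro!: umor_conj_closed\<close>)

lemma umor_conj_one:
  assumes m: "m \<in> U_morphisms G U"
  shows "umor_conj G m \<one>\<^bsub>G\<^esub> = m"
proof (rule umor_eqI[OF G U])
  have P: "x \<in> carrier G" if "x \<in> fst m" for x
    using umor_subset[OF G U m] that by blast
  then show fst: "fst (umor_conj G m \<one>\<^bsub>G\<^esub>) = fst m"
    by (simp add: fst_umor_conj G.conj_set_one subsetI)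
  show "umor_hom G (umor_conj G m \<one>\<^bsub>G\<^esub>) x = umor_hom G m x"
    if "x \<in> fst (umor_conj G m \<one>\<^bsub>G\<^esub>)" for x
    using umor_hom_conj[OF m G.one_closed, of x] that P[of x] by (simp add: fst)
qed (use assms in \<open>auto intro!: umor_conj_closed\<close>)

text \<open>Conjugation changes the source and \<alpha> the target: at the conjugate of y both sides
  give \<alpha> of the value of \<phi> at y.\<close>

lemma umor_aut_conj:
  assumes m: "m \<in> U_morphisms G U" and a: "a \<in> carrier G" and \<alpha>: "\<alpha> \<in> carrier (Aut U)"
  shows "umor_aut G (umor_conj G m a) \<alpha> = umor_conj G (umor_aut G m \<alpha>) a"
proof (rule umor_eqI[OF G U])
  fix x assume x: "x \<in> fst (umor_aut G (umor_conj G m a) \<alpha>)"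
  then obtain y where "y \<in> fst m" "x = inv\<^bsub>G\<^esub> a \<otimes>\<^bsub>G\<^esub> y \<otimes>\<^bsub>G\<^esub> a"
    by (auto simp: fst_umor_conj fst_umor_aut conj_set_def)
  with x show "umor_hom G (umor_aut G (umor_conj G m a) \<alpha>) x
      = umor_hom G (umor_conj G (umor_aut G m \<alpha>) a) x"
    using umor_hom_conj[OF m a] umor_hom_conj[OF umor_aut_closed[OF m \<alpha>] a]
    by (simp add: umor_hom_aut fst_umor_aut)
qed (use assms in \<open>auto simp: fst_umor_conj fst_umor_aut intro!: umor_conj_closed umor_aut_closed\<close>)

lemma umor_aut_one:
  assumes m: "m \<in> U_morphisms G U"
  shows "umor_aut G m \<one>\<^bsub>Aut U\<^esub> = m"
proof (rule umor_eqI[OF G U])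
  show "umor_aut G m \<one>\<^bsub>Aut U\<^esub> \<in> U_morphisms G U"
    using m monoid.one_closed[OF group.is_monoid[OF group_Aut[OF U]]] by (rule umor_aut_closed)
qed (use umor_hom_closed[OF G U m] in \<open>simp_all add: m fst_umor_aut umor_hom_aut one_Aut\<close>)

text \<open>The reversed product of \<open>Aut U\<close> applies \<alpha> first and then \<beta>, as
  a right action requires.\<close>

lemma umor_aut_aut:
  assumes m: "m \<in> U_morphisms G U" and "\<alpha> \<in> carrier (Aut U)" "\<beta> \<in> carrier (Aut U)"
  shows "umor_aut G m (\<alpha> \<otimes>\<^bsub>Aut U\<^esub> \<beta>) = umor_aut G (umor_aut G m \<alpha>) \<beta>"
proof (rule umor_eqI[OF G U])
  show "umor_aut G m (\<alpha> \<otimes>\<^bsub>Aut U\<^esub> \<beta>) \<in> U_morphisms G U"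
    using m monoid.m_closed[OF group.is_monoid[OF group_Aut[OF U]] assms(2,3)]
    by (rule umor_aut_closed)
qed (use assms umor_hom_closed[OF G U m] in
  \<open>simp_all add: umor_aut_closed fst_umor_aut umor_hom_aut mult_Aut compose_def\<close>)

lemma biset_umor: "biset G (Aut U) (umor_biset G U)"
proof -
  interpret Aut: group "Aut U"
    using U by (rule group_Aut)
  show ?thesis
    by unfold_locales
      (simp_all add: umor_biset_def umor_conj_closed umor_aut_closed umor_conj_one umor_aut_one
        umor_conj_conj G.inv_mult_group umor_aut_aut umor_aut_conj)
qed

end


section \<open>The map \<open>\<Pi>\<close>\<close>

context
  fixes G1 :: "('a, 'm) monoid_scheme" and G2 :: "('b, 'n) monoid_scheme"
    and U :: "('u, 'k) monoid_scheme"
  assumes G1: "group G1" and G2: "group G2" and U: "group U"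
begin

interpretation G1: group G1 by (rule G1)
interpretation G2: group G2 by (rule G2)
interpretation U: group U by (rule U)
interpretation G: group "G1 \<times>\<times> G2" by (rule DirProd_group[OF G1 G2])

text \<open>Both morphisms are bijections onto U, so the inverse of \<theta>2 sends \<theta>1 S to T
  exactly when \<theta>1 S = \<theta>2 T. This removes \<open>inv_into\<close> and exhibits a fibre
  product.\<close>

lemma umor_Pi_eq:
  assumes "m1 \<in> U_morphisms G1 U" "m2 \<in> U_morphisms G2 U"
  shows "umor_Pi G1 G2 m1 m2 = {(a, b) \<in> fst m1 \<times> fst m2. umor_hom G1 m1 a = umor_hom G2 m2 b}"
proof -
  obtain P1 K1 \<theta>1 P2 K2 \<theta>2 where eq: "m1 = (P1, K1, \<theta>1)" "m2 = (P2, K2, \<theta>2)"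
    by (cases m1; cases m2)
  let ?C1 = "carrier (sec_quot G1 P1 K1)" and ?C2 = "carrier (sec_quot G2 P2 K2)"
  have "bij_betw \<theta>1 ?C1 (carrier U)" "bij_betw \<theta>2 ?C2 (carrier U)"
    using assms by (auto simp: eq U_morphisms_def iso_def)
  then have inv: "inv_into ?C2 \<theta>2 (\<theta>1 S) = T \<longleftrightarrow> \<theta>1 S = \<theta>2 T" if "S \<in> ?C1" "T \<in> ?C2" for S T
    using that by (metis bij_betw_apply bij_betw_inv_into_left bij_betw_inv_into_right)
  have "(a, b) \<in> umor_Pi G1 G2 m1 m2 \<longleftrightarrow>
      a \<in> P1 \<and> b \<in> P2 \<and> \<theta>1 (K1 #>\<^bsub>G1\<^esub> a) = \<theta>2 (K2 #>\<^bsub>G2\<^esub> b)" for a b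
  proof (cases "a \<in> P1 \<and> b \<in> P2")
    case True
    then have "K1 #>\<^bsub>G1\<^esub> a \<in> ?C1" "K2 #>\<^bsub>G2\<^esub> b \<in> ?C2"
      by (auto simp: carrier_sec_quot)
    with True inv show ?thesis
      by (simp add: eq umor_Pi_def section_graph_def compose_eq)
  qed (auto simp: eq umor_Pi_def section_graph_def)
  then show ?thesis
    by (auto simp: eq umor_hom_def)
qed

text \<open>Conjugating a morphism leaves the values of \<phi> unchanged at corresponding points, so
  the equation of the fibre product is preserved. Taking \<open>a\<close> or \<open>b\<close> to be
  the identity gives the one-sided actions.\<close>

lemma umor_Pi_conj:
  assumes m: "m1 \<in> U_morphisms G1 U" "m2 \<in> U_morphisms G2 U"
    and ab: "a \<in> carrier G1" "b \<in> carrier G2"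
  shows "umor_Pi G1 G2 (umor_conj G1 m1 a) (umor_conj G2 m2 b)
    = conj_set (G1 \<times>\<times> G2) (a, b) (umor_Pi G1 G2 m1 m2)"
proof -
  have "umor_Pi G1 G2 (umor_conj G1 m1 a) (umor_conj G2 m2 b)
    = {(inv\<^bsub>G1\<^esub> a \<otimes>\<^bsub>G1\<^esub> x \<otimes>\<^bsub>G1\<^esub> a, inv\<^bsub>G2\<^esub> b \<otimes>\<^bsub>G2\<^esub> y \<otimes>\<^bsub>G2\<^esub> b) | x y. (x, y) \<in> umor_Pi G1 G2 m1 m2}"
    using umor_hom_conj[OF G1 U m(1) ab(1)] umor_hom_conj[OF G2 U m(2) ab(2)]
    by (fastforce simp: umor_Pi_eq m ab umor_conj_closed[OF G1 U] umor_conj_closed[OF G2 U]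
        fst_umor_conj conj_set_def)
  then show ?thesis
    using ab by (force simp: conj_set_def G1 G2)
qed

lemma umor_Pi_in_U_subgroups:
  assumes m: "m1 \<in> U_morphisms G1 U" "m2 \<in> U_morphisms G2 U"
  shows "umor_Pi G1 G2 m1 m2 \<in> U_subgroups G1 G2 U"
proof -
  obtain P1 K1 \<theta>1 P2 K2 \<theta>2 where eq: "m1 = (P1, K1, \<theta>1)" "m2 = (P2, K2, \<theta>2)"
    by (cases m1; cases m2)
  let ?Q1 = "sec_quot G1 P1 K1" and ?Q2 = "sec_quot G2 P2 K2"
  have sec: "is_section G1 P1 K1" "is_section G2 P2 K2"
    and \<theta>: "\<theta>1 \<in> iso ?Q1 U" "\<theta>2 \<in> iso ?Q2 U"
    using m by (auto simp: eq U_morphisms_def)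
  interpret Q1: group ?Q1
    using sec(1) by (simp add: is_section_def sec_quot_def normal.factorgroup_is_group)
  interpret Q2: group ?Q2
    using sec(2) by (simp add: is_section_def sec_quot_def normal.factorgroup_is_group)
  have "inv_into (carrier ?Q2) \<theta>2 \<circ> \<theta>1 \<in> iso ?Q1 ?Q2"
    using \<theta>(1) Q2.iso_set_sym[OF \<theta>(2)] by (rule iso_set_trans)
  \<comment> \<open>\<open>compose\<close> agrees with ordinary composition on the cosets, which is
    all that \<open>iso\<close> sees.\<close>
  then have \<tau>: "compose (carrier ?Q1) (inv_into (carrier ?Q2) \<theta>2) \<theta>1 \<in> iso ?Q1 ?Q2"
    by (rule Q1.iso_eq) (simp add: compose_def)
  have "subgroup (umor_Pi G1 G2 m1 m2) (G1 \<times>\<times> G2)"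
  proof -
    interpret P1: subgroup "fst m1" G1
      using umor_subgroup[OF G1 U m(1)] .
    interpret P2: subgroup "fst m2" G2
      using umor_subgroup[OF G2 U m(2)] .
    show ?thesis
      by unfold_locales
        (auto simp: umor_Pi_eq[OF m] umor_hom_mult[OF G1 U m(1)] umor_hom_mult[OF G2 U m(2)]
          umor_hom_one[OF G1 U m(1)] umor_hom_one[OF G2 U m(2)]
          umor_hom_inv[OF G1 U m(1)] umor_hom_inv[OF G2 U m(2)] G1 G2)
  qed
  then show ?thesis
    using sec \<tau> is_isoI[OF \<theta>(1)] is_isoI[OF \<theta>(2)]
    unfolding U_subgroups_def eq umor_Pi_def prod.case by blast
qed

text \<open>Surjectivity of \<Pi>: for any isomorphism \<beta> from P2/K2 to U, the map \<theta> is
  \<theta>\<beta> followed by the inverse of \<beta>, so \<theta>\<beta> and \<beta> form a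
  preimage. They are restricted to become extensional.\<close>

lemma U_subgroupsE:
  assumes "L \<in> U_subgroups G1 G2 U"
  obtains m1 m2 where "m1 \<in> U_morphisms G1 U" "m2 \<in> U_morphisms G2 U" "L = umor_Pi G1 G2 m1 m2"
proof -
  obtain P1 K1 P2 K2 \<theta> \<beta> where sec: "is_section G1 P1 K1" "is_section G2 P2 K2"
    and \<theta>: "\<theta> \<in> iso (sec_quot G1 P1 K1) (sec_quot G2 P2 K2)"
    and L: "L = section_graph G1 G2 P1 K1 P2 K2 \<theta>"
    and \<beta>: "\<beta> \<in> iso (sec_quot G2 P2 K2) U"
    using assms unfolding U_subgroups_def is_iso_def by blast
  let ?Q1 = "sec_quot G1 P1 K1" and ?Q2 = "sec_quot G2 P2 K2"
  interpret Q1: group ?Q1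
    using sec(1) by (simp add: is_section_def sec_quot_def normal.factorgroup_is_group)
  interpret Q2: group ?Q2
    using sec(2) by (simp add: is_section_def sec_quot_def normal.factorgroup_is_group)
  let ?m1 = "(P1, K1, restrict (\<beta> \<circ> \<theta>) (carrier ?Q1))"
  let ?m2 = "(P2, K2, restrict \<beta> (carrier ?Q2))"
  have "restrict (\<beta> \<circ> \<theta>) (carrier ?Q1) \<in> iso ?Q1 U"
    using iso_set_trans[OF \<theta> \<beta>] by (rule Q1.iso_eq) simp
  moreover have "restrict \<beta> (carrier ?Q2) \<in> iso ?Q2 U"
    using \<beta> by (rule Q2.iso_eq) simp
  ultimately have m: "?m1 \<in> U_morphisms G1 U" "?m2 \<in> U_morphisms G2 U"
    using sec by (auto simp: U_morphisms_def)
  have "\<beta> (\<theta> S) = \<beta> T \<longleftrightarrow> \<theta> S = T" if "S \<in> carrier ?Q1" "T \<in> carrier ?Q2" for S T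
  proof -
    have "\<theta> S \<in> carrier ?Q2" "inj_on \<beta> (carrier ?Q2)"
      using \<theta> \<beta> that by (auto simp: iso_def bij_betw_def)
    then show ?thesis
      using that by (auto dest: inj_onD)
  qed
  then have "L = umor_Pi G1 G2 ?m1 ?m2"
    unfolding umor_Pi_eq[OF m] L section_graph_def
    by (auto simp: umor_hom_def carrier_sec_quot)
  with m show thesis
    by (rule that)
qed

text \<open>
  If \<open>\<Pi>(\<theta>\<^sub>1, \<theta>\<^sub>2) = \<Pi>(\<theta>\<^sub>1', \<theta>\<^sub>2')\<close>, then the automorphism
  \<open>\<theta>\<^sub>1\<^sup>-\<^sup>1\<theta>\<^sub>1' = \<theta>\<^sub>2\<^sup>-\<^sup>1\<theta>\<^sub>2'\<close> of \<open>U\<close> carries one pair to the other.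
\<close>

lemma umor_Pi_eq_iff:
  assumes m: "m1 \<in> U_morphisms G1 U" "m2 \<in> U_morphisms G2 U"
    and m': "m1' \<in> U_morphisms G1 U" "m2' \<in> U_morphisms G2 U"
  shows "umor_Pi G1 G2 m1 m2 = umor_Pi G1 G2 m1' m2' \<longleftrightarrow>
    (\<exists>\<alpha> \<in> carrier (Aut U). m1' = umor_aut G1 m1 \<alpha> \<and> m2' = umor_aut G2 m2 \<alpha>)"
proof
  assume "\<exists>\<alpha> \<in> carrier (Aut U). m1' = umor_aut G1 m1 \<alpha> \<and> m2' = umor_aut G2 m2 \<alpha>"
  then obtain \<alpha> where \<alpha>: "\<alpha> \<in> carrier (Aut U)"
    and eq: "m1' = umor_aut G1 m1 \<alpha>" "m2' = umor_aut G2 m2 \<alpha>"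
    by blast
  \<comment> \<open>By injectivity, applying \<alpha> to both sides of the fibre product equation
    does not change its solutions.\<close>
  have "\<alpha> u = \<alpha> v \<longleftrightarrow> u = v" if "u \<in> carrier U" "v \<in> carrier U" for u v
    using \<alpha> that by (auto simp: carrier_Aut Bij_def bij_betw_def inj_on_def)
  then have "{(a, b) \<in> fst m1 \<times> fst m2. umor_hom G1 m1 a = umor_hom G2 m2 b}
    = {(a, b) \<in> fst m1 \<times> fst m2. \<alpha> (umor_hom G1 m1 a) = \<alpha> (umor_hom G2 m2 b)}"
    using umor_hom_closed[OF G1 U m(1)] umor_hom_closed[OF G2 U m(2)] by auto
  then show "umor_Pi G1 G2 m1 m2 = umor_Pi G1 G2 m1' m2'"
    unfolding umor_Pi_eq[OF m] umor_Pi_eq[OF m']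
    by (auto simp: eq fst_umor_aut umor_hom_aut)
next
  assume Pi: "umor_Pi G1 G2 m1 m2 = umor_Pi G1 G2 m1' m2'"
  let ?\<phi>1 = "umor_hom G1 m1" and ?\<phi>2 = "umor_hom G2 m2"
  let ?\<phi>1' = "umor_hom G1 m1'" and ?\<phi>2' = "umor_hom G2 m2'"
  have graph: "x \<in> fst m1 \<and> y \<in> fst m2 \<and> ?\<phi>1 x = ?\<phi>2 y \<longleftrightarrow>
    x \<in> fst m1' \<and> y \<in> fst m2' \<and> ?\<phi>1' x = ?\<phi>2' y" for x y
    using Pi unfolding umor_Pi_eq[OF m] umor_Pi_eq[OF m'] by blast
  \<comment> \<open>Since the values of the second homomorphism exhaust U, every element of P1 has a
    partner in P2; thus P1 is the projection of the common graph.\<close>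
  have fst1: "fst m1 = fst m1'"
    using graph umor_hom_closed[OF G1 U m(1)] umor_hom_preimage[OF G2 U m(2)]
      umor_hom_closed[OF G1 U m'(1)] umor_hom_preimage[OF G2 U m'(2)]
    by (metis subsetI subset_antisym)
  have fst2: "fst m2 = fst m2'"
    using graph umor_hom_closed[OF G2 U m(2)] umor_hom_preimage[OF G1 U m(1)]
      umor_hom_closed[OF G2 U m'(2)] umor_hom_preimage[OF G1 U m'(1)]
    by (metis subsetI subset_antisym)
  have \<phi>: "?\<phi>1 x = ?\<phi>2 y \<longleftrightarrow> ?\<phi>1' x = ?\<phi>2' y" if "x \<in> fst m1" "y \<in> fst m2" for x y
    using graph[of x y] that fst1 fst2 by simp
  \<comment> \<open>A common partner z of x in P2 tests whether x and y have equal values, so the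
    old and new homomorphisms on P1 have the same fibres.\<close>
  have \<phi>1: "?\<phi>1 x = ?\<phi>1 y \<longleftrightarrow> ?\<phi>1' x = ?\<phi>1' y" if xy: "x \<in> fst m1" "y \<in> fst m1" for x y
  proof -
    obtain z where "z \<in> fst m2" "?\<phi>2 z = ?\<phi>1 x"
      using umor_hom_preimage[OF G2 U m(2)] umor_hom_closed[OF G1 U m(1) xy(1)] .
    then show ?thesis
      using \<phi> xy by metis
  qed
  \<comment> \<open>\<open>s\<close> chooses preimages under the first homomorphism; \<alpha> then
    sends a value to the new value at the chosen preimage, independently of the choice by
    \<open>\<phi>1\<close>.\<close>
  define s where "s u = (SOME x. x \<in> fst m1 \<and> ?\<phi>1 x = u)" for u
  have s: "s u \<in> fst m1" "?\<phi>1 (s u) = u" if u: "u \<in> carrier U" for u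
    unfolding s_def using someI_ex[of "\<lambda>x. x \<in> fst m1 \<and> ?\<phi>1 x = u"]
      umor_hom_preimage[OF G1 U m(1) u] by blast+
  define \<alpha> where "\<alpha> = (\<lambda>u \<in> carrier U. ?\<phi>1' (s u))"
  have \<alpha>1: "\<alpha> (?\<phi>1 x) = ?\<phi>1' x" if "x \<in> fst m1" for x
    using \<phi>1[of "s (?\<phi>1 x)" x] s umor_hom_closed[OF G1 U m(1)] that by (simp add: \<alpha>_def)
  \<comment> \<open>The same \<alpha> serves the second factor, because the chosen preimage of the
    value at y is a partner of y in both graphs.\<close>
  have \<alpha>2: "\<alpha> (?\<phi>2 y) = ?\<phi>2' y" if "y \<in> fst m2" for y
    using \<phi>[of "s (?\<phi>2 y)" y] s umor_hom_closed[OF G2 U m(2)] that by (simp add: \<alpha>_def)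
  have "\<alpha> \<in> hom U U"
  proof (rule homI)
    show "\<alpha> u \<in> carrier U" if "u \<in> carrier U" for u
      using s[OF that] umor_hom_closed[OF G1 U m'(1)] that by (simp add: \<alpha>_def fst1)
    show "\<alpha> (u \<otimes>\<^bsub>U\<^esub> v) = \<alpha> u \<otimes>\<^bsub>U\<^esub> \<alpha> v" if uv: "u \<in> carrier U" "v \<in> carrier U" for u v
    proof -
      obtain x y where x: "x \<in> fst m1" "?\<phi>1 x = u" and y: "y \<in> fst m1" "?\<phi>1 y = v"
        using s uv by metis
      have "x \<otimes>\<^bsub>G1\<^esub> y \<in> fst m1"
        using x y subgroup.m_closed[OF umor_subgroup[OF G1 U m(1)]] by blast
      then have "\<alpha> (?\<phi>1 x \<otimes>\<^bsub>U\<^esub> ?\<phi>1 y) = ?\<phi>1' (x \<otimes>\<^bsub>G1\<^esub> y)"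
        using \<alpha>1 umor_hom_mult[OF G1 U m(1)] x y by metis
      then show ?thesis
        using \<alpha>1 umor_hom_mult[OF G1 U m'(1)] x y fst1 by auto
    qed
  qed
  \<comment> \<open>Injectivity is the converse direction of \<open>\<phi>1\<close>.\<close>
  moreover have "inj_on \<alpha> (carrier U)"
    using \<phi>1 s by (metis (no_types, lifting) \<alpha>1 inj_onI)
  moreover have "\<alpha> ` carrier U = carrier U"
  proof -
    have "\<alpha> ` ?\<phi>1 ` fst m1 = ?\<phi>1' ` fst m1"
      using \<alpha>1 by (simp add: image_image cong: image_cong)
    then show ?thesis
      using umor_hom_image[OF G1 U m(1)] umor_hom_image[OF G1 U m'(1)] fst1 by simp
  qed
  \<comment> \<open>\<open>Bij\<close> admits only extensional maps, whence the restriction to U in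
    the definition of \<alpha>.\<close>
  ultimately have \<alpha>: "\<alpha> \<in> carrier (Aut U)"
    by (simp add: carrier_Aut Bij_def bij_betw_def \<alpha>_def)
  have "m1' = umor_aut G1 m1 \<alpha>"
    using \<alpha>1 fst1 m(1) m'(1) \<alpha>
    by (intro umor_eqI[OF G1 U]) (auto simp: fst_umor_aut umor_hom_aut umor_aut_closed[OF G1 U])
  moreover have "m2' = umor_aut G2 m2 \<alpha>"
    using \<alpha>2 fst2 m(2) m'(2) \<alpha>
    by (intro umor_eqI[OF G2 U]) (auto simp: fst_umor_aut umor_hom_aut umor_aut_closed[OF G2 U])
  ultimately show "\<exists>\<alpha> \<in> carrier (Aut U). m1' = umor_aut G1 m1 \<alpha> \<and> m2' = umor_aut G2 m2 \<alpha>"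
    using \<alpha> by blast
qed

text \<open>Writing \<open>L\<close> as a value of \<Pi>, its conjugate is the value at the
  conjugated morphisms.\<close>

lemma conj_set_U_subgroups:
  assumes L: "L \<in> U_subgroups G1 G2 U" and ab: "a \<in> carrier G1" "b \<in> carrier G2"
  shows "conj_set (G1 \<times>\<times> G2) (a, b) L \<in> U_subgroups G1 G2 U"
proof -
  obtain m1 m2 where m: "m1 \<in> U_morphisms G1 U" "m2 \<in> U_morphisms G2 U"
    and L: "L = umor_Pi G1 G2 m1 m2"
    using L by (rule U_subgroupsE)
  show ?thesis
    unfolding L umor_Pi_conj[OF m ab, symmetric]
    using m ab by (intro umor_Pi_in_U_subgroups umor_conj_closed G1 G2 U)
qed

lemma biset_usub: "biset G1 G2 (usub_biset G1 G2 U)"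
proof -
  have sub: "L \<subseteq> carrier (G1 \<times>\<times> G2)" if "L \<in> U_subgroups G1 G2 U" for L
    using that unfolding U_subgroups_def by (blast dest: subgroup.subset)
  \<comment> \<open>One composition law for pairs yields both actions and their commuting, as they
    use different components.\<close>
  have comp: "conj_set (G1 \<times>\<times> G2) (a, b) (conj_set (G1 \<times>\<times> G2) (c, d) L)
      = conj_set (G1 \<times>\<times> G2) (c \<otimes>\<^bsub>G1\<^esub> a, d \<otimes>\<^bsub>G2\<^esub> b) L"
    if "L \<in> U_subgroups G1 G2 U" "a \<in> carrier G1" "b \<in> carrier G2" "c \<in> carrier G1" "d \<in> carrier G2"
    for L a b c d
    using G.conj_set_conj_set[of "(a, b)" "(c, d)" L] sub[OF that(1)] that by simp
  have one: "conj_set (G1 \<times>\<times> G2) (\<one>\<^bsub>G1\<^esub>, \<one>\<^bsub>G2\<^esub>) L = L" if "L \<in> U_subgroups G1 G2 U" for L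
    using G.conj_set_one[OF sub[OF that]] by simp
  show ?thesis
    by unfold_locales
      (simp_all add: usub_biset_def conj_set_U_subgroups comp one G1.inv_mult_group)
qed

end

section \<open>The isomorphism of bisets induced by \<Pi>\<close>

theorem proposition5p1:
  fixes G1 :: "('a, 'm) monoid_scheme"
    and G2 :: "('b, 'n) monoid_scheme"
    and U :: "('u, 'k) monoid_scheme"
  assumes "group G1" and "finite (carrier G1)"
    and "group G2" and "finite (carrier G2)"
    and "group U" and "finite (carrier U)"
  shows "\<exists>f \<in> biset_iso G1 G2
      (tensor_biset (Aut U) (umor_biset G1 U) (opposite_biset G2 (Aut U) (umor_biset G2 U)))
      (usub_biset G1 G2 U).
    \<forall>\<theta>1 \<in> U_morphisms G1 U. \<forall>\<theta>2 \<in> U_morphisms G2 U.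
      f (orbit (Aut U)
          (middle_act (Aut U) (umor_biset G1 U) (opposite_biset G2 (Aut U) (umor_biset G2 U)))
          (\<theta>1, \<theta>2))
      = umor_Pi G1 G2 \<theta>1 \<theta>2"
proof -
  note G1 = assms(1) and G2 = assms(3) and U = assms(5)
  interpret G1: group G1 by (rule G1)
  interpret G2: group G2 by (rule G2)
  let ?X = "umor_biset G1 U" and ?Y = "opposite_biset G2 (Aut U) (umor_biset G2 U)"
  have X: "bset ?X = U_morphisms G1 U" "lact ?X a m = umor_conj G1 m (inv\<^bsub>G1\<^esub> a)"
    "ract ?X = umor_aut G1" for a m
    by (simp_all add: umor_biset_def)
  interpret Aut: group "Aut U"
    using U by (rule group_Aut)
  have Y: "bset ?Y = U_morphisms G2 U"
    "lact ?Y \<alpha> n = umor_aut G2 n (inv\<^bsub>Aut U\<^esub> \<alpha>)"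
    "b \<in> carrier G2 \<Longrightarrow> ract ?Y n b = umor_conj G2 n b" for \<alpha> n b
    by (simp_all add: umor_biset_def opposite_biset_def)
  have S: "bset (usub_biset G1 G2 U) = U_subgroups G1 G2 U"
    "lact (usub_biset G1 G2 U) a L = conj_set (G1 \<times>\<times> G2) (inv\<^bsub>G1\<^esub> a, \<one>\<^bsub>G2\<^esub>) L"
    "ract (usub_biset G1 G2 U) L b = conj_set (G1 \<times>\<times> G2) (\<one>\<^bsub>G1\<^esub>, b) L" for a b L
    by (simp_all add: usub_biset_def)
  interpret tensor_bisets G1 "Aut U" G2 ?X ?Y
    using biset_umor[OF G1 U] biset_opposite[OF biset_umor[OF G2 U]]
    by (rule tensor_bisets.intro)
  have "\<exists>f \<in> biset_iso G1 G2 (tensor_biset (Aut U) ?X ?Y) (usub_biset G1 G2 U).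
    \<forall>x \<in> bset ?X. \<forall>y \<in> bset ?Y. f (middle_orbit (x, y)) = umor_Pi G1 G2 x y"
  proof (rule tensor_induced_iso[OF biset_usub[OF G1 G2 U]])
    show "(\<lambda>(x, y). umor_Pi G1 G2 x y) ` (bset ?X \<times> bset ?Y) = bset (usub_biset G1 G2 U)"
      by (auto simp: X Y S umor_Pi_in_U_subgroups[OF G1 G2 U]
          elim!: U_subgroupsE[OF G1 G2 U])
  next
    fix x y x' y'
    assume "x \<in> bset ?X" "y \<in> bset ?Y" "x' \<in> bset ?X" "y' \<in> bset ?Y"
    \<comment> \<open>The inverse in the middle action cancels the one in the opposite biset, so the
      same \<alpha> acts on both morphisms, as in \<open>umor_Pi_eq_iff\<close>.\<close>
    then show "umor_Pi G1 G2 x y = umor_Pi G1 G2 x' y' \<longleftrightarrow>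
      (\<exists>\<alpha> \<in> carrier (Aut U). x' = ract ?X x \<alpha> \<and> y' = lact ?Y (inv\<^bsub>Aut U\<^esub> \<alpha>) y)"
      by (simp add: X Y umor_Pi_eq_iff[OF G1 G2 U])
  next
    fix a x y assume "a \<in> carrier G1" "x \<in> bset ?X" "y \<in> bset ?Y"
    \<comment> \<open>The untouched morphism is viewed as conjugated by the identity, so that
      \<open>umor_Pi_conj\<close> applies; the right action is treated likewise.\<close>
    then show "umor_Pi G1 G2 (lact ?X a x) y = lact (usub_biset G1 G2 U) a (umor_Pi G1 G2 x y)"
      by (simp add: X Y S umor_conj_one[OF G2 U] flip: umor_Pi_conj[OF G1 G2 U])
  next
    fix b x y assume "b \<in> carrier G2" "x \<in> bset ?X" "y \<in> bset ?Y"
    then show "umor_Pi G1 G2 x (ract ?Y y b) = ract (usub_biset G1 G2 U) (umor_Pi G1 G2 x y) b"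
      by (simp add: X Y S umor_conj_one[OF G1 U] flip: umor_Pi_conj[OF G1 G2 U])
  qed
  then show ?thesis
    by (simp add: X Y)
qed

end
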